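(* Let $n>2$. Let $\mathcal U'_{r,s}(\widehat{\mathfrak{sl}_n})$ be the subalgebra of $\mathcal U_{r,s}(\widehat{\mathfrak{sl}_n})$ generated by $E_i,F_i,\omega_i^{\pm1},\omega_i'^{\pm1}$ ($i\in I_0$), $\gamma^{\pm1/2},\gamma'^{\pm1/2},D^{\pm1},D'^{\pm1}$. Then for every $i\in I$: (1) $a_i(\ell)\in\mathcal U'_{r,s}(\widehat{\mathfrak{sl}_n})$ for all $\ell\in\mathbb Z\setminus\{0\}$; (2) $x_i^\pm(k)\in\mathcal U'_{r,s}(\widehat{\mathfrak{sl}_n})$ for all $k\in\mathbb Z$.
   Context: Base field: $\mathbb K=\mathbb Q(r,s)$, rational functions in two indeterminates (so $r\ne\pm s$), with square roots $r^{1/2},s^{1/2}$ adjoined; half-integral powers of monomials in $r,s$ are formed from these. $I=\{1,\dots,n-1\}$, $I_0=\{0\}\cup I$; $\varepsilon_1,\dots,\varepsilon_n$ orthonormal, $\alpha_i=\varepsilon_i-\varepsilon_{i+1}$, $a_{ij}=(\alpha_i,\alpha_j)$. For $i,j\in I$, $\langle i,j\rangle=r^{(\varepsilon_j,\alpha_i)}s^{(\varepsilon_{j+1},\alpha_i)}$, i.e. $\langle i,i\rangle=rs^{-1}$, $\langle i,i+1\rangle=r^{-1}$, $\langle i+1,i\rangle=s$, $\langle i,j\rangle=1$ if $|i-j|>1$. Quantum bracket: $[a,b]_q=ab-q\,ba$, $[a,b]=[a,b]_1$. **$\mathcal U_{r,s}(\widehat{\mathfrak{sl}_n})$** is the unital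 associative $\mathbb K$-algebra generated by $x_i^\pm(k)$, $a_i(\ell)$, $\omega_i^{\pm1},\omega_i'^{\pm1}$, $\gamma^{\pm1/2},\gamma'^{\pm1/2}$, $D^{\pm1},D'^{\pm1}$ ($i\in I$, $k\in\mathbb Z$, $\ell\in\mathbb Z\setminus\{0\}$) with relations: (D1) $\gamma^{\pm1/2},\gamma'^{\pm1/2}$ are central, $\gamma\gamma'=rs$ (with $\gamma^{1/2}\gamma'^{1/2}=(rs)^{1/2}$); $\omega_i^{\pm1},\omega_i'^{\pm1},D^{\pm1},D'^{\pm1}$ commute with one another, exponents $\pm1$ denoting inverses. (D2) $[a_i(\ell),a_j(\ell')]=\delta_{\ell+\ell',0}\frac{(rs)^{|\ell|/2}(\langle i,i\rangle^{\ell a_{ij}/2}-\langle i,i\rangle^{-\ell a_{ij}/2})}{|\ell|(r-s)}\cdot\frac{\gamma^{|\ell|}-\gamma'^{|\ell|}}{r-s}$. (D3) $[a_i(\ell),\omega_j^{\pm1}]=[a_i(\ell),\omega_j'^{\pm1}]=0$. (D4) $Dx_i^\pm(k)D^{-1}=r^kx_i^\pm(k)$, $D'x_i^\pm(k)D'^{-1}=s^kx_i^\pm(k)$, $Da_i(\ell)D^{-1}=r^\ell a_i(\ell)$, $D'a_i(\ell)D'^{-1}=s^\ell a_i(\ell)$. (D5) $\omega_ix_j^\pm(k)\omega_i^{-1}=\langle j,i\rangle^{\pm1}x_j^\pm(k)$, $\omega_i'x_j^\pm(k)\omega_i'^{-1}=\langle i,j\rangle^{\mp1}x_j^\pm(k)$.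 (D6) $[a_i(\ell),x_j^\pm(k)]=\pm\frac{(rs)^{|\ell|/2}(\langle i,i\rangle^{\ell a_{ij}/2}-\langle i,i\rangle^{-\ell a_{ij}/2})}{\ell(r-s)}\,c\;x_j^\pm(\ell+k)$ with $c=\gamma^{\pm\ell/2}$ if $\ell<0$ and $c=\gamma'^{\pm\ell/2}$ if $\ell>0$. (D7) $x_i^\pm(k+1)x_j^\pm(k')-\langle j,i\rangle^{\pm1}x_j^\pm(k')x_i^\pm(k+1)=-(\langle j,i\rangle\langle i,j\rangle^{-1})^{\pm1/2}\big(x_j^\pm(k'+1)x_i^\pm(k)-\langle i,j\rangle^{\pm1}x_i^\pm(k)x_j^\pm(k'+1)\big)$. (D8) $[x_i^+(k),x_j^-(k')]=\frac{\delta_{ij}}{r-s}\big(\gamma'^{-k}\gamma^{-(k+k')/2}\omega_i(k+k')-\gamma^{k'}\gamma'^{(k+k')/2}\omega_i'(k+k')\big)$, where $\sum_{m\ge0}\omega_i(m)z^{-m}=\omega_i\exp\big((r-s)\sum_{\ell\ge1}a_i(\ell)z^{-\ell}\big)$, $\sum_{m\ge0}\omega_i'(-m)z^m=\omega_i'\exp\big(-(r-s)\sum_{\ell\ge1}a_i(-\ell)z^\ell\big)$, and $\omega_i(-m)=0=\omega_i'(m)$ for $m>0$. (D9) $x_i^\pm(m)x_j^\pm(k)=x_j^\pm(k)x_i^\pm(m)$ if $a_{ij}=0$; and if $a_{ij}=-1$, $\mathrm{Sym}_{m_1,m_2}\big(x_i^\pm(m_1)x_i^\pm(m_2)x_j^\pm(k)-(p+q)x_i^\pm(m_1)x_j^\pm(k)x_i^\pm(m_2)+pq\,x_j^\pm(k)x_i^\pm(m_1)x_i^\pm(m_2)\big)=0$,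 where $(p,q)=(r^{\pm1},s^{\pm1})$ if $i<j$ and $(p,q)=(r^{\mp1},s^{\mp1})$ if $j<i$; $\mathrm{Sym}$ is symmetrization in $(m_1,m_2)$. Elements: $\omega_\theta=\omega_1\cdots\omega_{n-1}$, $\omega'_\theta=\omega'_1\cdots\omega'_{n-1}$, $\omega_0=\gamma'^{-1}\omega_\theta^{-1}$, $\omega_0'=\gamma^{-1}\omega_\theta'^{-1}$; $E_i=x_i^+(0)$, $F_i=x_i^-(0)$ for $i\in I$; $E_0=x_\theta^-(1)\gamma'^{-1}\omega_\theta^{-1}$, $F_0=\gamma^{-1}\omega_\theta'^{-1}x_\theta^+(-1)$, where $x_\theta^-(1)=[x_{n-1}^-(0),\cdots,[x_2^-(0),x_1^-(1)]_s\cdots]_s$ and $x_\theta^+(-1)=[\cdots[x_1^+(-1),x_2^+(0)]_r,\cdots,x_{n-1}^+(0)]_r$. *)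

theory Defs
  imports
    "HOL-Computational_Algebra.Fraction_Field"
    "HOL-Computational_Algebra.Polynomial"
    "HOL-Computational_Algebra.Formal_Power_Series"
    "HOL-Library.Poly_Mapping"
    "HOL-Algebra.QuotRing"
    "HOL-Algebra.Generated_Rings"
begin

section \<open>The base field\<close>

text \<open>
  Adjoining square roots of two indeterminates \<open>r, s\<close> to the rational function field over the
  rationals gives the rational function field in the two indeterminates \<open>r\<^sup>1\<^sup>/\<^sup>2, s\<^sup>1\<^sup>/\<^sup>2\<close>. This is the
  form in which the field is constructed.
\<close>

type_synonym scalars = "rat poly poly fract"

definition r_half :: scalars where "r_half = Fraction_Field.Fract [:0, 1:] 1"

definition s_half :: scalars where "s_half = Fraction_Field.Fract [:[:0, 1:]:] 1"

definition par_r :: scalars where "par_r = r_half ^ 2"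

definition par_s :: scalars where "par_s = s_half ^ 2"

text \<open>\<open>monomial_half a b\<close> is the monomial with exponents \<open>a/2\<close> and \<open>b/2\<close> at \<open>r\<close> and \<open>s\<close>.\<close>

definition monomial_half :: "int \<Rightarrow> int \<Rightarrow> scalars" where
  "monomial_half a b = r_half powi a * s_half powi b"


section \<open>Cartan data of type A\<close>

text \<open>\<open>eps_root k i\<close> is the inner product of \<open>\<epsilon>\<^sub>k\<close> and \<open>\<alpha>\<^sub>i = \<epsilon>\<^sub>i - \<epsilon>\<^sub>i\<^sub>+\<^sub>1\<close>.\<close>

definition eps_root :: "nat \<Rightarrow> nat \<Rightarrow> int" where
  "eps_root k i = (if k = i then 1 else 0) - (if k = i + 1 then 1 else 0)"

definition cartan :: "nat \<Rightarrow> nat \<Rightarrow> int" where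
  "cartan i j = eps_root i j - eps_root (i + 1) j"

text \<open>
  \<open>pairing_half i j e\<close> is the power with exponent \<open>e/2\<close> of
  \<open>\<langle>i,j\<rangle> = r\<^bsup>(\<epsilon>\<^sub>j,\<alpha>\<^sub>i)\<^esup> s\<^bsup>(\<epsilon>\<^sub>j\<^sub>+\<^sub>1,\<alpha>\<^sub>i)\<^esup>\<close>; \<open>pairing i j e\<close> is the power with exponent \<open>e\<close>.
\<close>

definition pairing_half :: "nat \<Rightarrow> nat \<Rightarrow> int \<Rightarrow> scalars" where
  "pairing_half i j e = monomial_half (e * eps_root j i) (e * eps_root (j + 1) i)"

definition pairing :: "nat \<Rightarrow> nat \<Rightarrow> int \<Rightarrow> scalars" where
  "pairing i j e = pairing_half i j (2 * e)"

text \<open>The scalar \<open>(rs)\<^bsup>|l|/2\<^esup> (\<langle>i,i\<rangle>\<^bsup>l a\<^esup> - \<langle>i,i\<rangle>\<^bsup>- l a\<^esup>) / (r - s)\<close> with \<open>a = a\<^sub>i\<^sub>j / 2\<close>.\<close>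

definition heis_coeff :: "nat \<Rightarrow> nat \<Rightarrow> int \<Rightarrow> scalars" where
  "heis_coeff i j l = monomial_half \<bar>l\<bar> \<bar>l\<bar> *
     (pairing_half i i (l * cartan i j) - pairing_half i i (- (l * cartan i j))) / (par_r - par_s)"


section \<open>Free algebras\<close>

text \<open>
  Words form a monoid under concatenation, written additively because the convolution product of
  finitely supported functions is based on addition of the exponents.
\<close>

datatype 'g word = Word (letters: "'g list")

instantiation word :: (type) monoid_add
begin

definition "0 = Word []"

definition "u + v = Word (letters u @ letters v)"

instance
  by standard (simp_all add: zero_word_def plus_word_def)

end

datatype pm = Pos | Neg

fun sg :: "pm \<Rightarrow> int" where
  "sg Pos = 1"
| "sg Neg = - 1"

text \<open>
  The sign is the superscript for \<open>XGen\<close>; for all other letters it is the sign of the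
  exponent. So \<open>GamGen Neg\<close> and \<open>GamGen' Neg\<close> are the generators \<open>\<gamma>\<^sup>-\<^sup>1\<^sup>/\<^sup>2\<close> and \<open>\<gamma>'\<^sup>-\<^sup>1\<^sup>/\<^sup>2\<close>.
\<close>

datatype generator =
    XGen pm nat int
  | AGen nat int
  | OmGen pm nat
  | OmGen' pm nat
  | GamGen pm
  | GamGen' pm
  | DGen pm
  | DGen' pm

definition generators :: "nat \<Rightarrow> generator set" where
  "generators n =
     {XGen e i k | e i k. i \<in> {1..<n}} \<union> {AGen i l | i l. i \<in> {1..<n} \<and> l \<noteq> 0} \<union>
     {OmGen e i | e i. i \<in> {1..<n}} \<union> {OmGen' e i | e i. i \<in> {1..<n}} \<union>
     range GamGen \<union> range GamGen' \<union> range DGen \<union> range DGen'"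

type_synonym falg = "generator word \<Rightarrow>\<^sub>0 scalars"

definition free_algebra :: "nat \<Rightarrow> falg ring" where
  "free_algebra n =
     \<lparr>carrier = {p. \<forall>w \<in> Poly_Mapping.keys p. set (letters w) \<subseteq> generators n},
      mult = (*), one = 1, zero = 0, add = (+)\<rparr>"

definition scal :: "scalars \<Rightarrow> falg" where
  "scal c = Poly_Mapping.single 0 c"

definition gen :: "generator \<Rightarrow> falg" where
  "gen g = Poly_Mapping.single (Word [g]) 1"

definition xx :: "pm \<Rightarrow> nat \<Rightarrow> int \<Rightarrow> falg" where "xx e i k = gen (XGen e i k)"

definition aa :: "nat \<Rightarrow> int \<Rightarrow> falg" where "aa i l = gen (AGen i l)"

definition om :: "pm \<Rightarrow> nat \<Rightarrow> falg" where "om e i = gen (OmGen e i)"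

definition om' :: "pm \<Rightarrow> nat \<Rightarrow> falg" where "om' e i = gen (OmGen' e i)"

definition dd :: "pm \<Rightarrow> falg" where "dd e = gen (DGen e)"

definition dd' :: "pm \<Rightarrow> falg" where "dd' e = gen (DGen' e)"

text \<open>\<open>gam m\<close> and \<open>gam' m\<close> are the powers with exponent \<open>m/2\<close> of \<open>\<gamma>\<close> and \<open>\<gamma>'\<close>.\<close>

definition gam :: "int \<Rightarrow> falg" where
  "gam m = (if m \<ge> 0 then gen (GamGen Pos) ^ nat m else gen (GamGen Neg) ^ nat (- m))"

definition gam' :: "int \<Rightarrow> falg" where
  "gam' m = (if m \<ge> 0 then gen (GamGen' Pos) ^ nat m else gen (GamGen' Neg) ^ nat (- m))"

definition qbracket :: "scalars \<Rightarrow> falg \<Rightarrow> falg \<Rightarrow> falg" where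
  "qbracket q u v = u * v - scal q * (v * u)"

text \<open>
  The exponential of a power series without constant term: only the powers up to the \<open>m\<close>-th
  contribute to the \<open>m\<close>-th coefficient.
\<close>

definition fps_exp_nc :: "falg fps \<Rightarrow> falg fps" where
  "fps_exp_nc A = Abs_fps (\<lambda>m. \<Sum>j\<le>m. scal (1 / of_nat (fact j)) * fps_nth (A ^ j) m)"

text \<open>The formal variable is \<open>z\<^sup>-\<^sup>1\<close> for \<open>\<omega>\<^sub>i(m)\<close> and \<open>z\<close> for \<open>\<omega>'\<^sub>i(-m)\<close>.\<close>

definition om_series :: "nat \<Rightarrow> falg fps" where
  "om_series i = fps_const (om Pos i) *
     fps_exp_nc (Abs_fps (\<lambda>l. if l = 0 then 0 else scal (par_r - par_s) * aa i (int l)))"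

definition om_series' :: "nat \<Rightarrow> falg fps" where
  "om_series' i = fps_const (om' Pos i) *
     fps_exp_nc (Abs_fps (\<lambda>l. if l = 0 then 0 else - (scal (par_r - par_s) * aa i (- int l))))"

definition om_mode :: "nat \<Rightarrow> int \<Rightarrow> falg" where
  "om_mode i m = (if m \<ge> 0 then fps_nth (om_series i) (nat m) else 0)"

definition om_mode' :: "nat \<Rightarrow> int \<Rightarrow> falg" where
  "om_mode' i m = (if m \<le> 0 then fps_nth (om_series' i) (nat (- m)) else 0)"

definition serre :: "pm \<Rightarrow> nat \<Rightarrow> nat \<Rightarrow> scalars \<Rightarrow> scalars \<Rightarrow> int \<Rightarrow> int \<Rightarrow> int \<Rightarrow> falg" where
  "serre e i j p q m1 m2 k =
     xx e i m1 * xx e i m2 * xx e j k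
     - scal (p + q) * (xx e i m1 * xx e j k * xx e i m2)
     + scal (p * q) * (xx e j k * xx e i m1 * xx e i m2)"


section \<open>The Drinfeld realization\<close>

inductive drinfeld_rel :: "nat \<Rightarrow> falg \<Rightarrow> falg \<Rightarrow> bool" for n :: nat where
  D1_gam_central:
    "g \<in> generators n \<Longrightarrow> drinfeld_rel n (gen (GamGen e) * gen g) (gen g * gen (GamGen e))"
| D1_gam'_central:
    "g \<in> generators n \<Longrightarrow> drinfeld_rel n (gen (GamGen' e) * gen g) (gen g * gen (GamGen' e))"
| D1_gam_gam': "drinfeld_rel n (gam 2 * gam' 2) (scal (par_r * par_s))"
| D1_gam_gam'_half: "drinfeld_rel n (gam 1 * gam' 1) (scal (monomial_half 1 1))"
| D1_gam_inv: "e \<noteq> f \<Longrightarrow> drinfeld_rel n (gen (GamGen e) * gen (GamGen f)) 1"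
| D1_gam'_inv: "e \<noteq> f \<Longrightarrow> drinfeld_rel n (gen (GamGen' e) * gen (GamGen' f)) 1"
| D1_om_inv: "\<lbrakk>i \<in> {1..<n}; e \<noteq> f\<rbrakk> \<Longrightarrow> drinfeld_rel n (om e i * om f i) 1"
| D1_om'_inv: "\<lbrakk>i \<in> {1..<n}; e \<noteq> f\<rbrakk> \<Longrightarrow> drinfeld_rel n (om' e i * om' f i) 1"
| D1_D_inv: "e \<noteq> f \<Longrightarrow> drinfeld_rel n (dd e * dd f) 1"
| D1_D'_inv: "e \<noteq> f \<Longrightarrow> drinfeld_rel n (dd' e * dd' f) 1"
| D1_torus_comm:
    "\<lbrakk>T = {om e i | e i. i \<in> {1..<n}} \<union> {om' e i | e i. i \<in> {1..<n}} \<union> range dd \<union> range dd';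
      u \<in> T; v \<in> T\<rbrakk> \<Longrightarrow> drinfeld_rel n (u * v) (v * u)"
| D2:
    "\<lbrakk>i \<in> {1..<n}; j \<in> {1..<n}; l \<noteq> 0; l' \<noteq> 0\<rbrakk> \<Longrightarrow>
     drinfeld_rel n (qbracket 1 (aa i l) (aa j l'))
       (if l + l' = 0
        then scal (heis_coeff i j l / of_int \<bar>l\<bar> / (par_r - par_s)) *
          (gam (2 * \<bar>l\<bar>) - gam' (2 * \<bar>l\<bar>))
        else 0)"
| D3_om:
    "\<lbrakk>i \<in> {1..<n}; j \<in> {1..<n}; l \<noteq> 0\<rbrakk> \<Longrightarrow> drinfeld_rel n (qbracket 1 (aa i l) (om e j)) 0"
| D3_om':
    "\<lbrakk>i \<in> {1..<n}; j \<in> {1..<n}; l \<noteq> 0\<rbrakk> \<Longrightarrow> drinfeld_rel n (qbracket 1 (aa i l) (om' e j)) 0"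
| D4_D_x:
    "i \<in> {1..<n} \<Longrightarrow> drinfeld_rel n (dd Pos * xx e i k * dd Neg) (scal (par_r powi k) * xx e i k)"
| D4_D'_x:
    "i \<in> {1..<n} \<Longrightarrow> drinfeld_rel n (dd' Pos * xx e i k * dd' Neg) (scal (par_s powi k) * xx e i k)"
| D4_D_a:
    "\<lbrakk>i \<in> {1..<n}; l \<noteq> 0\<rbrakk> \<Longrightarrow>
     drinfeld_rel n (dd Pos * aa i l * dd Neg) (scal (par_r powi l) * aa i l)"
| D4_D'_a:
    "\<lbrakk>i \<in> {1..<n}; l \<noteq> 0\<rbrakk> \<Longrightarrow>
     drinfeld_rel n (dd' Pos * aa i l * dd' Neg) (scal (par_s powi l) * aa i l)"
| D5_om:
    "\<lbrakk>i \<in> {1..<n}; j \<in> {1..<n}\<rbrakk> \<Longrightarrow>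
     drinfeld_rel n (om Pos i * xx e j k * om Neg i) (scal (pairing j i (sg e)) * xx e j k)"
| D5_om':
    "\<lbrakk>i \<in> {1..<n}; j \<in> {1..<n}\<rbrakk> \<Longrightarrow>
     drinfeld_rel n (om' Pos i * xx e j k * om' Neg i) (scal (pairing i j (- sg e)) * xx e j k)"
| D6:
    "\<lbrakk>i \<in> {1..<n}; j \<in> {1..<n}; l \<noteq> 0\<rbrakk> \<Longrightarrow>
     drinfeld_rel n (qbracket 1 (aa i l) (xx e j k))
       (scal (of_int (sg e) * heis_coeff i j l / of_int l) *
        (if l < 0 then gam (sg e * l) else gam' (sg e * l)) * xx e j (l + k))"
| D7:
    "\<lbrakk>i \<in> {1..<n}; j \<in> {1..<n}\<rbrakk> \<Longrightarrow>
     drinfeld_rel n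
       (xx e i (k + 1) * xx e j k' - scal (pairing j i (sg e)) * (xx e j k' * xx e i (k + 1)))
       (- (scal (pairing_half j i (sg e) * pairing_half i j (- sg e)) *
           (xx e j (k' + 1) * xx e i k -
            scal (pairing i j (sg e)) * (xx e i k * xx e j (k' + 1)))))"
| D8:
    "\<lbrakk>i \<in> {1..<n}; j \<in> {1..<n}\<rbrakk> \<Longrightarrow>
     drinfeld_rel n (qbracket 1 (xx Pos i k) (xx Neg j k'))
       (if i = j
        then scal (1 / (par_r - par_s)) *
          (gam' (- 2 * k) * gam (- (k + k')) * om_mode i (k + k') -
           gam (2 * k') * gam' (k + k') * om_mode' i (k + k'))
        else 0)"
| D9_comm:
    "\<lbrakk>i \<in> {1..<n}; j \<in> {1..<n}; cartan i j = 0\<rbrakk> \<Longrightarrow>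
     drinfeld_rel n (xx e i m * xx e j k) (xx e j k * xx e i m)"
| D9_serre_less:
    "\<lbrakk>i \<in> {1..<n}; j \<in> {1..<n}; cartan i j = - 1; i < j;
      p = par_r powi sg e; q = par_s powi sg e\<rbrakk> \<Longrightarrow>
     drinfeld_rel n (serre e i j p q m1 m2 k + serre e i j p q m2 m1 k) 0"
| D9_serre_greater:
    "\<lbrakk>i \<in> {1..<n}; j \<in> {1..<n}; cartan i j = - 1; j < i;
      p = par_r powi (- sg e); q = par_s powi (- sg e)\<rbrakk> \<Longrightarrow>
     drinfeld_rel n (serre e i j p q m1 m2 k + serre e i j p q m2 m1 k) 0"

definition drinfeld_ideal :: "nat \<Rightarrow> falg set" where
  "drinfeld_ideal n = Idl\<^bsub>free_algebra n\<^esub> {u - v | u v. drinfeld_rel n u v}"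

definition U_rs :: "nat \<Rightarrow> falg set ring" where
  "U_rs n = free_algebra n Quot drinfeld_ideal n"

definition U_proj :: "nat \<Rightarrow> falg \<Rightarrow> falg set" where
  "U_proj n u = drinfeld_ideal n +>\<^bsub>free_algebra n\<^esub> u"


section \<open>The subalgebra generated by the Chevalley-type elements\<close>

definition om_theta :: "nat \<Rightarrow> falg" where
  "om_theta n = prod_list (map (om Pos) [1..<n])"

definition om_theta_inv :: "nat \<Rightarrow> falg" where
  "om_theta_inv n = prod_list (map (om Neg) (rev [1..<n]))"

definition om_theta' :: "nat \<Rightarrow> falg" where
  "om_theta' n = prod_list (map (om' Pos) [1..<n])"

definition om_theta_inv' :: "nat \<Rightarrow> falg" where
  "om_theta_inv' n = prod_list (map (om' Neg) (rev [1..<n]))"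

text \<open>
  \<open>x_minus_upto m\<close> is \<open>[x\<^sup>-\<^sub>m(0), \<dots> [x\<^sup>-\<^sub>2(0), x\<^sup>-\<^sub>1(1)]\<^sub>s \<dots>]\<^sub>s\<close> and \<open>x_plus_upto m\<close> is
  \<open>[\<dots> [x\<^sup>+\<^sub>1(-1), x\<^sup>+\<^sub>2(0)]\<^sub>r, \<dots>, x\<^sup>+\<^sub>m(0)]\<^sub>r\<close>, for \<open>m \<ge> 1\<close>; the value at \<open>0\<close> is a dummy.
\<close>

fun x_minus_upto :: "nat \<Rightarrow> falg" where
  "x_minus_upto 0 = 0"
| "x_minus_upto (Suc 0) = xx Neg 1 1"
| "x_minus_upto (Suc (Suc m)) = qbracket par_s (xx Neg (Suc (Suc m)) 0) (x_minus_upto (Suc m))"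

fun x_plus_upto :: "nat \<Rightarrow> falg" where
  "x_plus_upto 0 = 0"
| "x_plus_upto (Suc 0) = xx Pos 1 (- 1)"
| "x_plus_upto (Suc (Suc m)) = qbracket par_r (x_plus_upto (Suc m)) (xx Pos (Suc (Suc m)) 0)"

definition chev_E :: "nat \<Rightarrow> nat \<Rightarrow> falg" where
  "chev_E n i =
     (if i = 0 then x_minus_upto (n - 1) * gam' (- 2) * om_theta_inv n else xx Pos i 0)"

definition chev_F :: "nat \<Rightarrow> nat \<Rightarrow> falg" where
  "chev_F n i =
     (if i = 0 then gam (- 2) * om_theta_inv' n * x_plus_upto (n - 1) else xx Neg i 0)"

definition chev_om :: "nat \<Rightarrow> pm \<Rightarrow> nat \<Rightarrow> falg" where
  "chev_om n e i =
     (if i = 0 then (case e of Pos \<Rightarrow> gam' (- 2) * om_theta_inv n | Neg \<Rightarrow> om_theta n * gam' 2)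
      else om e i)"

definition chev_om' :: "nat \<Rightarrow> pm \<Rightarrow> nat \<Rightarrow> falg" where
  "chev_om' n e i =
     (if i = 0 then (case e of Pos \<Rightarrow> gam (- 2) * om_theta_inv' n | Neg \<Rightarrow> om_theta' n * gam 2)
      else om' e i)"

definition chev_generators :: "nat \<Rightarrow> falg set" where
  "chev_generators n =
     chev_E n ` {0..<n} \<union> chev_F n ` {0..<n} \<union>
     {chev_om n e i | e i. i \<in> {0..<n}} \<union> {chev_om' n e i | e i. i \<in> {0..<n}} \<union>
     range (\<lambda>e. gen (GamGen e)) \<union> range (\<lambda>e. gen (GamGen' e)) \<union> range dd \<union> range dd'"

text \<open>The scalars are included because \<open>generate_ring\<close> only generates a subring, not a subalgebra.\<close>

definition U_sub :: "nat \<Rightarrow> falg set set" where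
  "U_sub n = generate_ring (U_rs n) (U_proj n ` (range scal \<union> chev_generators n))"

end

theory Submission
  imports Defs
begin

text \<open>
  Stripping \<open>x\<^sub>\<theta>\<^sup>-(1)\<close> with \<open>x\<^sub>m\<^sup>+(0)\<close>, for \<open>m = n-1, \<dots>, 2\<close>, leaves \<open>x\<^sub>1\<^sup>-(1)\<close> up to
  units: the \<open>\<omega>'\<^sub>m\<close> part of \<open>[x\<^sub>m\<^sup>+(0), x\<^sub>m\<^sup>-(0)]\<close> cancels in the \<open>s\<close>-bracket and the \<open>\<omega>\<^sub>m\<close> part
  does not. In the same way \<open>x\<^sub>\<theta>\<^sup>+(-1)\<close> yields \<open>x\<^sub>1\<^sup>+(-1)\<close>. Relation (D8) then gives
  \<open>a\<^sub>1(\<plusminus>1)\<close>, and by (D6) bracketing with \<open>a\<^sub>i(\<plusminus>1)\<close> shifts the modes of \<open>x\<^sub>j\<^sup>\<plusminus>\<close> whenever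
  \<open>a\<^sub>i\<^sub>j \<noteq> 0\<close>, so one moves along the Dynkin diagram from \<open>i\<close> to \<open>i+1\<close>. Finally the \<open>a\<^sub>i(l)\<close> are
  read off recursively from the coefficients of the exponential series in (D8).
\<close>

section \<open>Scalar multiples in the free algebra\<close>

lemma scal_0 [simp]: "scal 0 = 0" and scal_1 [simp]: "scal 1 = 1"
  by (simp_all add: scal_def flip: zero_word_def)

lemma scal_add: "scal (c + d) = scal c + scal d"
  by (simp add: scal_def single_add)

lemma scal_uminus: "scal (- c) = - scal c"
  by (metis add.right_inverse neg_eq_iff_add_eq_0 scal_0 scal_add)

lemma scal_diff: "scal (c - d) = scal c - scal d"
  by (metis add_uminus_conv_diff scal_add scal_uminus)

lemma scal_mult: "scal (c * d) = scal c * scal d"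
  by (simp add: scal_def mult_single)

text \<open>Scalars sit on the empty word, which is neutral on both sides, and the coefficient field
  is commutative. The induction adds one monomial at a time.\<close>

lemma scal_commute: "scal c * u = u * scal c"
proof (induction u rule: update_induct)
  case const
  then show ?case by simp
next
  case (update f a b)
  \<comment> \<open>The key \<open>a\<close> does not occur in \<open>f\<close>, so overwriting its
    coefficient is the same as adding a monomial.\<close>
  have "Poly_Mapping.update a b f = f + Poly_Mapping.single a b"
    using update.hyps
    by (intro poly_mapping_eqI) (auto simp: lookup_update lookup_add lookup_single in_keys_iff)
  then show ?case
    using update.IH by (simp add: algebra_simps scal_def mult_single)
qed

text \<open>As a module action, scalars can be pulled out of products and collected by the general
  scaling laws, which \<open>scal\<close> as an ordinary factor would not allow.\<close>

definition cmult :: "scalars \<Rightarrow> falg \<Rightarrow> falg" where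
  "cmult c u = scal c * u"

interpretation cmult: Modules.module cmult
  by standard (simp_all add: cmult_def algebra_simps scal_add scal_mult)

lemma cmult_mult_left: "cmult c u * v = cmult c (u * v)"
  by (simp add: cmult_def mult.assoc)

lemma cmult_mult_right: "u * cmult c v = cmult c (u * v)"
  by (metis cmult_def scal_commute mult.assoc)

lemmas cmult_simps = cmult_mult_left cmult_mult_right

lemma qbracket_cmult: "qbracket q u v = u * v - cmult q (v * u)"
  by (simp add: qbracket_def cmult_def)

section \<open>The quotient map\<close>

lemma free_algebra_sel [simp]:
  "mult (free_algebra n) = (*)" "one (free_algebra n) = 1"
  "zero (free_algebra n) = 0" "add (free_algebra n) = (+)"
  by (simp_all add: free_algebra_def)

abbreviation fcarr :: "nat \<Rightarrow> falg set" where
  "fcarr n \<equiv> carrier (free_algebra n)"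

section \<open>Membership in the carrier of the free algebra\<close>

lemma scal_carrier: "scal c \<in> fcarr n"
  by (auto simp: free_algebra_def scal_def zero_word_def)

lemma gen_carrier: "g \<in> generators n \<Longrightarrow> gen g \<in> fcarr n"
  by (auto simp: free_algebra_def gen_def)

lemma add_carrier: "u \<in> fcarr n \<Longrightarrow> v \<in> fcarr n \<Longrightarrow> u + v \<in> fcarr n"
  using keys_add[of u v] by (fastforce simp: free_algebra_def)

lemma mult_carrier: "u \<in> fcarr n \<Longrightarrow> v \<in> fcarr n \<Longrightarrow> u * v \<in> fcarr n"
  using keys_mult[of u v] by (fastforce simp: free_algebra_def plus_word_def)

lemma one_carrier: "1 \<in> fcarr n" and zero_carrier: "0 \<in> fcarr n"
  using scal_carrier[of 1 n] scal_carrier[of 0 n] by simp_all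

lemma uminus_carrier: "u \<in> fcarr n \<Longrightarrow> - u \<in> fcarr n"
  using mult_carrier[OF scal_carrier[of "-1"], of u n] by (simp add: scal_uminus)

lemma diff_carrier: "u \<in> fcarr n \<Longrightarrow> v \<in> fcarr n \<Longrightarrow> u - v \<in> fcarr n"
  using add_carrier[OF _ uminus_carrier] by fastforce

lemma cmult_carrier: "u \<in> fcarr n \<Longrightarrow> cmult c u \<in> fcarr n"
  by (simp add: cmult_def mult_carrier scal_carrier)

lemma qbracket_carrier: "u \<in> fcarr n \<Longrightarrow> v \<in> fcarr n \<Longrightarrow> qbracket q u v \<in> fcarr n"
  by (simp add: qbracket_cmult diff_carrier mult_carrier cmult_carrier)

lemma power_carrier: "u \<in> fcarr n \<Longrightarrow> u ^ k \<in> fcarr n"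
  by (induction k) (auto simp: one_carrier mult_carrier)

lemma sum_carrier: "(\<And>x. x \<in> S \<Longrightarrow> f x \<in> fcarr n) \<Longrightarrow> sum f S \<in> fcarr n"
  by (induction S rule: infinite_finite_induct) (auto simp: zero_carrier add_carrier)

lemma prod_list_carrier: "(\<And>x. x \<in> set xs \<Longrightarrow> f x \<in> fcarr n) \<Longrightarrow> prod_list (map f xs) \<in> fcarr n"
  by (induction xs) (auto simp: one_carrier mult_carrier)

lemma gam_carrier: "gam m \<in> fcarr n" and gam'_carrier: "gam' m \<in> fcarr n"
  by (auto simp: gam_def gam'_def generators_def intro!: power_carrier gen_carrier)

lemma torus_carrier:
  "gen (GamGen e) \<in> fcarr n" "gen (GamGen' e) \<in> fcarr n" "dd e \<in> fcarr n" "dd' e \<in> fcarr n"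
  by (auto simp: generators_def dd_def dd'_def intro!: gen_carrier)

lemma indexed_gen_carrier:
  assumes "i \<in> {1..<n}"
  shows "xx e i k \<in> fcarr n" "l \<noteq> 0 \<Longrightarrow> aa i l \<in> fcarr n" "om e i \<in> fcarr n" "om' e i \<in> fcarr n"
  using assms
  by (auto simp: generators_def xx_def aa_def om_def om'_def intro!: gen_carrier)

lemma fps_power_carrier:
  assumes "\<And>m. fps_nth A m \<in> fcarr n"
  shows "fps_nth (A ^ j) m \<in> fcarr n"
  using assms
  by (induction j arbitrary: m)
    (auto simp: one_carrier zero_carrier fps_mult_nth intro!: sum_carrier mult_carrier)

lemma fps_exp_nc_carrier:
  assumes "\<And>m. fps_nth A m \<in> fcarr n"
  shows "fps_nth (fps_exp_nc A) m \<in> fcarr n"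
  unfolding fps_exp_nc_def
  by (simp, intro sum_carrier mult_carrier scal_carrier fps_power_carrier assms)

lemma om_mode_carrier:
  assumes "i \<in> {1..<n}"
  shows "om_mode i m \<in> fcarr n" "om_mode' i m \<in> fcarr n"
  using assms
  by (auto simp: om_mode_def om_mode'_def om_series_def om_series'_def
      intro!: mult_carrier fps_exp_nc_carrier indexed_gen_carrier scal_carrier zero_carrier
        uminus_carrier)

lemmas carrier_intros = scal_carrier add_carrier mult_carrier one_carrier zero_carrier
  uminus_carrier diff_carrier cmult_carrier qbracket_carrier gam_carrier gam'_carrier
  torus_carrier indexed_gen_carrier om_mode_carrier prod_list_carrier gen_carrier

lemma drinfeld_rel_carrier:
  assumes "drinfeld_rel n u v"
  shows "u \<in> fcarr n \<and> v \<in> fcarr n"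
  using assms
proof cases
  case (D1_torus_comm T u v)
  then show ?thesis by (auto intro!: carrier_intros)
qed (auto simp: serre_def intro!: carrier_intros)

lemma ring_free_algebra: "ring (free_algebra n)"
proof (rule ringI)
  show "abelian_group (free_algebra n)"
  proof (rule abelian_groupI)
    fix x assume "x \<in> fcarr n"
    then show "\<exists>y\<in>fcarr n. y \<oplus>\<^bsub>free_algebra n\<^esub> x = \<zero>\<^bsub>free_algebra n\<^esub>"
      by (intro bexI[of _ "- x"]) (auto intro: uminus_carrier)
  qed (auto intro: carrier_intros simp: add_ac)
  show "monoid (free_algebra n)"
    by (rule monoidI) (auto intro: carrier_intros simp: mult.assoc)
qed (auto simp: algebra_simps)

lemma a_minus_free_algebra:
  assumes "v \<in> fcarr n"
  shows "u \<ominus>\<^bsub>free_algebra n\<^esub> v = u - v"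
proof -
  interpret ring "free_algebra n" by (rule ring_free_algebra)
  have "\<ominus>\<^bsub>free_algebra n\<^esub> v = - v"
    using assms by (intro minus_equality) (auto intro: uminus_carrier)
  then show ?thesis by (simp add: a_minus_def)
qed

lemma drinfeld_relators_carrier: "{u - v | u v. drinfeld_rel n u v} \<subseteq> fcarr n"
  using drinfeld_rel_carrier by (auto intro: diff_carrier)

lemma ideal_drinfeld_ideal: "ideal (drinfeld_ideal n) (free_algebra n)"
  unfolding drinfeld_ideal_def
  by (rule ring.genideal_ideal[OF ring_free_algebra drinfeld_relators_carrier])

lemma U_proj_hom: "U_proj n \<in> ring_hom (free_algebra n) (U_rs n)"
  using ideal.rcos_ring_hom[OF ideal_drinfeld_ideal]
  by (simp add: U_rs_def U_proj_def[abs_def])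

lemma U_proj_rel:
  assumes "drinfeld_rel n u v"
  shows "U_proj n u = U_proj n v"
proof -
  interpret ideal "drinfeld_ideal n" "free_algebra n" by (rule ideal_drinfeld_ideal)
  have "u - v \<in> drinfeld_ideal n"
    using ring.genideal_self[OF ring_free_algebra drinfeld_relators_carrier] assms
    unfolding drinfeld_ideal_def by blast
  then show ?thesis
    unfolding U_proj_def using drinfeld_rel_carrier[OF assms]
    by (subst quotient_eq_iff_same_a_r_cos[OF ideal_axioms, symmetric])
      (auto simp: a_minus_free_algebra)
qed

section \<open>Congruence modulo the Drinfeld relations\<close>

text \<open>Computations are done on representatives, where ordinary ring arithmetic is available,
  instead of on cosets. The carrier conditions are built in because the quotient map is
  multiplicative and additive only there.\<close>

definition dcong :: "nat \<Rightarrow> falg \<Rightarrow> falg \<Rightarrow> bool" where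
  "dcong n u v \<longleftrightarrow> u \<in> fcarr n \<and> v \<in> fcarr n \<and> U_proj n u = U_proj n v"

lemma dcong_rel: "drinfeld_rel n u v \<Longrightarrow> dcong n u v"
  by (simp add: dcong_def U_proj_rel drinfeld_rel_carrier)

lemma dcong_refl: "u \<in> fcarr n \<Longrightarrow> dcong n u u"
  by (simp add: dcong_def)

lemma dcong_sym: "dcong n u v \<Longrightarrow> dcong n v u"
  by (simp add: dcong_def)

lemma dcong_trans [trans]: "dcong n u v \<Longrightarrow> dcong n v w \<Longrightarrow> dcong n u w"
  by (simp add: dcong_def)

lemma dcong_mult: "dcong n u u' \<Longrightarrow> dcong n v v' \<Longrightarrow> dcong n (u * v) (u' * v')"
  using ring_hom_mult[OF U_proj_hom] by (auto simp: dcong_def mult_carrier)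

lemma dcong_add: "dcong n u u' \<Longrightarrow> dcong n v v' \<Longrightarrow> dcong n (u + v) (u' + v')"
  using ring_hom_add[OF U_proj_hom] by (auto simp: dcong_def add_carrier)

lemma dcong_cmult: "dcong n u v \<Longrightarrow> dcong n (cmult c u) (cmult c v)"
  by (simp add: cmult_def dcong_mult dcong_refl scal_carrier)

lemma dcong_diff: "dcong n u u' \<Longrightarrow> dcong n v v' \<Longrightarrow> dcong n (u - v) (u' - v')"
  using dcong_add[of n u u' "cmult (-1) v" "cmult (-1) v'"] dcong_cmult[of n v v' "-1"]
  by simp

lemmas dcong_intros = dcong_mult dcong_add dcong_diff dcong_cmult

section \<open>The subalgebra, seen on representatives\<close>

text \<open>This preimage is closed under algebra operations and under \<open>dcong\<close>. Both
  claims of the theorem become membership statements about it.\<close>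

definition U_pre :: "nat \<Rightarrow> falg set" where
  "U_pre n = {u \<in> fcarr n. U_proj n u \<in> U_sub n}"

lemma U_pre_dcong: "u \<in> U_pre n \<Longrightarrow> dcong n u v \<Longrightarrow> v \<in> U_pre n"
  by (auto simp: U_pre_def dcong_def)

lemma U_pre_mult: "u \<in> U_pre n \<Longrightarrow> v \<in> U_pre n \<Longrightarrow> u * v \<in> U_pre n"
  using ring_hom_mult[OF U_proj_hom]
  by (auto simp: U_pre_def mult_carrier U_sub_def intro: generate_ring.eng_mult)

lemma U_pre_add: "u \<in> U_pre n \<Longrightarrow> v \<in> U_pre n \<Longrightarrow> u + v \<in> U_pre n"
  using ring_hom_add[OF U_proj_hom]
  by (auto simp: U_pre_def add_carrier U_sub_def intro: generate_ring.eng_add)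

lemma U_pre_scal: "scal c \<in> U_pre n"
  by (auto simp: U_pre_def scal_carrier U_sub_def intro: generate_ring.incl)

lemma U_pre_cmult: "u \<in> U_pre n \<Longrightarrow> cmult c u \<in> U_pre n"
  by (simp add: cmult_def U_pre_mult U_pre_scal)

lemma U_pre_diff: "u \<in> U_pre n \<Longrightarrow> v \<in> U_pre n \<Longrightarrow> u - v \<in> U_pre n"
  using U_pre_add[of u n "cmult (-1) v"] U_pre_cmult[of v n "-1"] by simp

lemma U_pre_qbracket: "u \<in> U_pre n \<Longrightarrow> v \<in> U_pre n \<Longrightarrow> qbracket q u v \<in> U_pre n"
  by (simp add: qbracket_cmult U_pre_mult U_pre_cmult U_pre_diff)

lemma U_pre_0: "0 \<in> U_pre n" and U_pre_1: "1 \<in> U_pre n"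
  using U_pre_scal[of 0 n] U_pre_scal[of 1 n] by simp_all

lemma U_pre_power: "u \<in> U_pre n \<Longrightarrow> u ^ k \<in> U_pre n"
  by (induction k) (auto simp: U_pre_mult U_pre_1)

lemma U_pre_sum: "(\<And>x. x \<in> S \<Longrightarrow> f x \<in> U_pre n) \<Longrightarrow> sum f S \<in> U_pre n"
  by (induction S rule: infinite_finite_induct) (auto simp: U_pre_0 U_pre_add)

lemma U_pre_prod_list: "(\<And>x. x \<in> set xs \<Longrightarrow> f x \<in> U_pre n) \<Longrightarrow> prod_list (map f xs) \<in> U_pre n"
  by (induction xs) (auto simp: U_pre_1 U_pre_mult)

text \<open>Multiplying by \<open>w\<close> undoes \<open>v\<close> modulo the relations. This
  strips invertible torus factors whose inverses are already known to lie in the subalgebra.\<close>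

lemma U_pre_cancel_right:
  assumes "u * v \<in> U_pre n" "w \<in> U_pre n" "dcong n (v * w) 1" "u \<in> fcarr n"
  shows "u \<in> U_pre n"
proof (rule U_pre_dcong)
  show "u * v * w \<in> U_pre n" using assms by (simp add: U_pre_mult)
  show "dcong n (u * v * w) u"
    using dcong_mult[OF dcong_refl assms(3), of u] assms(4) by (simp add: mult.assoc)
qed

lemma U_pre_cancel_left:
  assumes "v * u \<in> U_pre n" "w \<in> U_pre n" "dcong n (w * v) 1" "u \<in> fcarr n"
  shows "u \<in> U_pre n"
proof (rule U_pre_dcong)
  show "w * (v * u) \<in> U_pre n" using assms by (simp add: U_pre_mult)
  show "dcong n (w * (v * u)) u"
    using dcong_mult[OF assms(3) dcong_refl, of u] assms(4) by (simp add: mult.assoc[symmetric])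
qed

lemma U_pre_cmult_cancel:
  assumes "cmult c u \<in> U_pre n" "c \<noteq> 0"
  shows "u \<in> U_pre n"
  using U_pre_cmult[OF assms(1), of "inverse c"] assms(2) by simp

lemma U_pre_gen:
  assumes "u \<in> chev_generators n" "u \<in> fcarr n"
  shows "u \<in> U_pre n"
  using assms by (auto simp: U_pre_def U_sub_def intro: generate_ring.incl)

lemma U_pre_torus:
  shows "gen (GamGen e) \<in> U_pre n" "gen (GamGen' e) \<in> U_pre n"
  by (rule U_pre_gen; auto simp: chev_generators_def intro: carrier_intros)+

lemma U_pre_gam: "gam m \<in> U_pre n" "gam' m \<in> U_pre n"
  by (auto simp: gam_def gam'_def intro: U_pre_power U_pre_torus)

lemma U_pre_chev:
  assumes "i \<in> {1..<n}"
  shows "xx e i 0 \<in> U_pre n" "om e i \<in> U_pre n" "om' e i \<in> U_pre n"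
proof -
  have "xx e i 0 \<in> chev_generators n"
  proof (cases e)
    case Pos
    have "xx Pos i 0 = chev_E n i" using assms by (simp add: chev_E_def)
    then show ?thesis using assms Pos by (auto simp: chev_generators_def)
  next
    case Neg
    have "xx Neg i 0 = chev_F n i" using assms by (simp add: chev_F_def)
    then show ?thesis using assms Neg by (auto simp: chev_generators_def)
  qed
  then show "xx e i 0 \<in> U_pre n" by (rule U_pre_gen) (rule indexed_gen_carrier(1)[OF assms])
  have "om e i = chev_om n e i" "om' e i = chev_om' n e i"
    using assms by (simp_all add: chev_om_def chev_om'_def)
  then have "om e i \<in> chev_generators n" "om' e i \<in> chev_generators n"
    using assms unfolding chev_generators_def by auto
  then show "om e i \<in> U_pre n" "om' e i \<in> U_pre n"
    using assms by (auto intro!: U_pre_gen indexed_gen_carrier simp del: atLeastLessThan_iff)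
qed

section \<open>Scalars\<close>

text \<open>\<open>r_half\<close> is the outer polynomial variable and \<open>s_half\<close> a
  constant with respect to it, so their \<open>k\<close>-th powers have outer degrees
  \<open>k\<close> and 0.\<close>

lemma r_half_power_neq_s_half_power:
  assumes "k > 0"
  shows "r_half ^ k \<noteq> s_half ^ k"
proof -
  have pow: "Fraction_Field.Fract a 1 ^ k = Fraction_Field.Fract (a ^ k) 1" for a :: "rat poly poly"
    by (induction k) (simp_all add: One_fract_def)
  have "degree ([:0, 1:] ^ k :: rat poly poly) = k"
    by (simp add: degree_power_eq)
  moreover have "degree ([:[:0, 1:]:] ^ k :: rat poly poly) = 0"
    by (simp add: degree_power_eq)
  ultimately have "([:0, 1:] :: rat poly poly) ^ k \<noteq> [:[:0, 1:]:] ^ k"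
    using assms by (metis less_irrefl)
  then show ?thesis
    by (simp add: r_half_def s_half_def pow eq_fract)
qed

lemma r_half_nonzero: "r_half \<noteq> 0" and s_half_nonzero: "s_half \<noteq> 0"
  by (simp_all add: r_half_def s_half_def Zero_fract_def eq_fract)

lemma par_nonzero: "par_r \<noteq> 0" "par_s \<noteq> 0"
  by (simp_all add: par_r_def par_s_def r_half_nonzero s_half_nonzero)

lemma par_r_neq_par_s: "par_r \<noteq> par_s"
  unfolding par_r_def par_s_def by (rule r_half_power_neq_s_half_power) simp

text \<open>A vanishing numerator would make the square root of r/s a root of unity. Nonvanishing
  allows the structure constants of (D6) to be divided out.\<close>

lemma heis_coeff_nonzero:
  assumes "l * cartan i j \<noteq> 0"
  shows "heis_coeff i j l \<noteq> 0"
proof -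
  \<comment> \<open>This is the square root of \<langle>i,i\<rangle> = r/s, the same for every
    \<open>i\<close>.\<close>
  define q where "q = r_half / s_half"
  have q: "q \<noteq> 0" by (simp add: q_def r_half_nonzero s_half_nonzero)
  have pairing: "pairing_half i i e = q powi e" for e
    by (simp add: pairing_half_def monomial_half_def eps_root_def q_def power_int_divide_distrib
        power_int_minus field_simps s_half_nonzero)
  have "q powi a \<noteq> q powi (- a)" if "a \<noteq> 0" for a
  proof
    assume "q powi a = q powi (- a)"
    then have "q powi (2 * a) = 1"
      using q by (simp add: power_int_minus field_simps flip: power_int_add)
    then have "q powi \<bar>2 * a\<bar> = 1"
      using q by (cases "a > 0") (auto simp: power_int_minus)
    then have "q ^ nat \<bar>2 * a\<bar> = 1" by (metis abs_ge_zero int_nat_eq power_int_of_nat)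
    then have "r_half ^ nat \<bar>2 * a\<bar> = s_half ^ nat \<bar>2 * a\<bar>"
      by (simp add: q_def power_divide s_half_nonzero)
    then show False using r_half_power_neq_s_half_power[of "nat \<bar>2 * a\<bar>"] that by simp
  qed
  then show ?thesis
    using assms par_r_neq_par_s r_half_nonzero s_half_nonzero
    by (simp add: heis_coeff_def pairing monomial_half_def)
qed

lemma pairing_eq:
  "pairing i j e = par_r powi (e * eps_root j i) * par_s powi (e * eps_root (j + 1) i)"
  by (simp add: pairing_def pairing_half_def monomial_half_def par_r_def par_s_def
      power_int_mult mult.assoc)

section \<open>Commutation up to scalars\<close>

text \<open>For a torus element \<open>w\<close>, the scalar is the weight of \<open>u\<close> under
  conjugation by \<open>w\<close>; the scalar 1 expresses plain commutation.\<close>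

definition qcomm :: "nat \<Rightarrow> scalars \<Rightarrow> falg \<Rightarrow> falg \<Rightarrow> bool" where
  "qcomm n c w u \<longleftrightarrow> w \<in> fcarr n \<and> u \<in> fcarr n \<and> dcong n (w * u) (cmult c (u * w))"

lemma qcomm_mult:
  assumes "qcomm n c w u" "qcomm n d w v"
  shows "qcomm n (c * d) w (u * v)"
proof -
  have carr: "w \<in> fcarr n" "u \<in> fcarr n" "v \<in> fcarr n"
    using assms by (auto simp: qcomm_def)
  have "dcong n (w * u * v) (cmult c (u * w) * v)"
    using assms carr by (intro dcong_mult dcong_refl) (auto simp: qcomm_def)
  also have "cmult c (u * w) * v = cmult c u * (w * v)"
    by (simp add: cmult_simps mult.assoc)
  also have "dcong n \<dots> (cmult c u * cmult d (v * w))"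
    using assms carr by (intro dcong_mult dcong_refl carrier_intros) (auto simp: qcomm_def)
  also have "cmult c u * cmult d (v * w) = cmult (c * d) (u * v * w)"
    by (simp add: cmult_simps mult.assoc mult.commute)
  finally show ?thesis using carr by (auto simp: qcomm_def mult.assoc intro: carrier_intros)
qed

text \<open>Both products in the bracket have weight \<open>c * d\<close>, the field being
  commutative, so the bracket is again homogeneous for every \<open>q\<close>.\<close>

lemma qcomm_qbracket:
  assumes "qcomm n c w u" "qcomm n d w v"
  shows "qcomm n (c * d) w (qbracket q u v)"
proof -
  have carr: "w \<in> fcarr n" "u \<in> fcarr n" "v \<in> fcarr n"
    using assms by (auto simp: qcomm_def)
  have "dcong n (w * (u * v) - cmult q (w * (v * u)))
    (cmult (c * d) (u * v * w) - cmult q (cmult (d * c) (v * u * w)))"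
    using qcomm_mult[OF assms] qcomm_mult[OF assms(2,1)]
    by (intro dcong_diff dcong_cmult) (auto simp: qcomm_def)
  moreover have "w * (u * v) - cmult q (w * (v * u)) = w * qbracket q u v"
    by (simp add: qbracket_cmult right_diff_distrib cmult_simps)
  moreover have "cmult (c * d) (u * v * w) - cmult q (cmult (d * c) (v * u * w))
    = cmult (c * d) (qbracket q u v * w)"
    by (simp add: qbracket_cmult left_diff_distrib cmult.scale_right_diff_distrib cmult_simps
        mult.assoc mult.commute)
  ultimately show ?thesis
    using carr by (simp add: qcomm_def qbracket_carrier)
qed

lemma dcong_cancel:
  assumes "dcong n (w * v) 1" "w \<in> fcarr n" "v \<in> fcarr n" "u \<in> fcarr n"
  shows "dcong n (u * w * v) u"
  using dcong_mult[OF dcong_refl assms(1), of u] assms(4) by (simp add: mult.assoc)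

text \<open>Multiplying the conjugation relation by \<open>w\<close> on the right removes the
  trailing inverse \<open>v\<close>. This brings (D5) into commutation form.\<close>

lemma qcomm_conj:
  assumes "dcong n (w * u * v) (scal c * u)" "dcong n (v * w) 1"
    and carr: "w \<in> fcarr n" "u \<in> fcarr n" "v \<in> fcarr n"
  shows "qcomm n c w u"
proof -
  have "dcong n (w * u) (w * u * v * w)"
    by (rule dcong_sym, rule dcong_cancel) (use assms in \<open>auto intro: carrier_intros\<close>)
  also have "dcong n \<dots> (scal c * u * w)"
    by (intro dcong_mult assms dcong_refl)
  finally show ?thesis using carr by (auto simp: qcomm_def cmult_def mult.assoc)
qed

lemma dcong_generator_inverse:
  assumes "e \<noteq> f"
  shows "dcong n (gen (GamGen e) * gen (GamGen f)) 1" "dcong n (gen (GamGen' e) * gen (GamGen' f)) 1"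
    "i \<in> {1..<n} \<Longrightarrow> dcong n (om e i * om f i) 1" "i \<in> {1..<n} \<Longrightarrow> dcong n (om' e i * om' f i) 1"
  using assms
  by (auto intro!: dcong_rel D1_gam_inv D1_gam'_inv D1_om_inv D1_om'_inv)

lemma qcomm_om:
  assumes "i \<in> {1..<n}" "j \<in> {1..<n}"
  shows "qcomm n (pairing j i (sg e)) (om Pos i) (xx e j k)"
  by (rule qcomm_conj[OF dcong_rel[OF D5_om[OF assms]] dcong_generator_inverse(3)])
    (use assms in \<open>simp_all add: indexed_gen_carrier\<close>)

lemma qcomm_om':
  assumes "i \<in> {1..<n}" "j \<in> {1..<n}"
  shows "qcomm n (pairing i j (- sg e)) (om' Pos i) (xx e j k)"
  by (rule qcomm_conj[OF dcong_rel[OF D5_om'[OF assms]] dcong_generator_inverse(4)])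
    (use assms in \<open>simp_all add: indexed_gen_carrier\<close>)

lemma dcong_diff_0:
  assumes "dcong n (u - v) 0" "u \<in> fcarr n" "v \<in> fcarr n"
  shows "dcong n u v"
  using dcong_add[OF assms(1) dcong_refl, of v] assms(3) by simp

lemma xx_pos_neg_commute:
  assumes "i \<in> {1..<n}" "j \<in> {1..<n}" "i \<noteq> j"
  shows "dcong n (xx Pos i k * xx Neg j k') (xx Neg j k' * xx Pos i k)"
proof (rule dcong_diff_0)
  show "dcong n (xx Pos i k * xx Neg j k' - xx Neg j k' * xx Pos i k) 0"
    using dcong_rel[OF D8[OF assms(1,2), of k k']] assms(3) by (simp add: qbracket_cmult)
qed (intro carrier_intros assms)+

lemma qcomm_xx:
  assumes "i \<in> {1..<n}" "j \<in> {1..<n}" "i \<noteq> j"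
  shows "qcomm n 1 (xx Pos i k) (xx Neg j k')" "qcomm n 1 (xx Neg i k) (xx Pos j k')"
  using xx_pos_neg_commute[OF assms] dcong_sym[OF xx_pos_neg_commute[OF assms(2,1)]] assms
  by (auto simp: qcomm_def indexed_gen_carrier)

text \<open>Each simple index up to \<open>k\<close> occurs exactly once in the nested bracket, so
  the weights multiply. The hypothesis covers all modes because the innermost factor has mode 1 and
  the others mode 0.\<close>

lemma qcomm_x_minus_upto:
  assumes "\<And>j l. 1 \<le> j \<Longrightarrow> j \<le> k \<Longrightarrow> qcomm n (c j) w (xx Neg j l)" "k \<ge> 1"
  shows "qcomm n (\<Prod>j=1..k. c j) w (x_minus_upto k)"
  using assms
proof (induction k rule: x_minus_upto.induct)
  case (3 m)
  then show ?case
    using qcomm_qbracket[of n "c (Suc (Suc m))" w "xx Neg (Suc (Suc m)) 0" "\<Prod>j=1..Suc m. c j"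
        "x_minus_upto (Suc m)"]
    by (simp add: mult.commute)
qed auto

lemma qcomm_x_plus_upto:
  assumes "\<And>j l. 1 \<le> j \<Longrightarrow> j \<le> k \<Longrightarrow> qcomm n (c j) w (xx Pos j l)" "k \<ge> 1"
  shows "qcomm n (\<Prod>j=1..k. c j) w (x_plus_upto k)"
  using assms
proof (induction k rule: x_plus_upto.induct)
  case (3 m)
  then show ?case
    using qcomm_qbracket[of n "\<Prod>j=1..Suc m. c j" w "x_plus_upto (Suc m)" "c (Suc (Suc m))"
        "xx Pos (Suc (Suc m)) 0"]
    by simp
qed auto

section \<open>Recovering the affine root vectors\<close>

lemma om_mode_0: "om_mode i 0 = om Pos i" and om_mode'_0: "om_mode' i 0 = om' Pos i"
  by (simp_all add: om_mode_def om_mode'_def om_series_def om_series'_def fps_exp_nc_def)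

lemma gam_0: "gam 0 = 1" and gam'_0: "gam' 0 = 1"
  by (simp_all add: gam_def gam'_def)

lemma xx_bracket_0:
  assumes "i \<in> {1..<n}"
  shows "dcong n (xx Pos i 0 * xx Neg i 0 - xx Neg i 0 * xx Pos i 0)
    (cmult (1 / (par_r - par_s)) (om Pos i - om' Pos i))"
  using dcong_rel[OF D8[OF assms assms, of 0 0]]
  by (simp add: om_mode_0 om_mode'_0 gam_0 gam'_0 qbracket_cmult cmult_def)

text \<open>The commutator with \<open>x\<close> is a derivation that kills \<open>z\<close>, so
  only \<open>y\<close> is hit, leaving the \<open>s\<close>-bracket of
  \<open>(w - w') / (r - s)\<close> with \<open>z\<close>. There \<open>w'\<close> drops out because
  its weight on \<open>z\<close> is \<open>s\<close>, while \<open>w\<close> contributes (1 -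
  s/r)/(r - s) = 1/r.\<close>

lemma peel_minus:
  assumes xy: "dcong n (x * y - y * x) (cmult (1 / (r - s)) (w - w'))"
    and xz: "qcomm n 1 x z" and wz: "qcomm n r w z" and wz': "qcomm n s w' z"
    and y: "y \<in> fcarr n" and rs: "r \<noteq> 0" "r \<noteq> s"
  shows "dcong n (x * qbracket s y z - qbracket s y z * x) (cmult (1 / r) (w * z))"
proof -
  define c where "c = 1 / (r - s)"
  have carr: "x \<in> fcarr n" "z \<in> fcarr n" "w \<in> fcarr n" "w' \<in> fcarr n"
    using xz wz wz' by (auto simp: qcomm_def)
  have xz0: "dcong n (x * z - z * x) 0"
    using dcong_diff[of n "x * z" "z * x" "z * x" "z * x"] xz carr
    by (auto simp: qcomm_def intro: dcong_refl carrier_intros)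
  \<comment> \<open>Leibniz rule for the commutator with \<open>x\<close>; the last group collects
    the terms containing the commutator of \<open>x\<close> and \<open>z\<close>.\<close>
  have "x * qbracket s y z - qbracket s y z * x
    = (x * y - y * x) * z - cmult s (z * (x * y - y * x))
      + (y * (x * z - z * x) - cmult s ((x * z - z * x) * y))"
    by (simp add: qbracket_cmult algebra_simps cmult_simps)
  also have "dcong n \<dots> (cmult c (w - w') * z - cmult s (z * cmult c (w - w'))
      + (y * 0 - cmult s (0 * y)))"
    using xy carr y by (intro dcong_intros xz0 dcong_refl) (auto simp: c_def)
  \<comment> \<open>The scalars are regrouped so that \<open>cmult r (z * w)\<close> and
    \<open>cmult s (z * w')\<close> appear, ready to be replaced by \<open>w * z\<close> and
    \<open>w' * z\<close>.\<close>
  also have "cmult c (w - w') * z - cmult s (z * cmult c (w - w')) + (y * 0 - cmult s (0 * y))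
    = cmult c (w * z) - cmult c (w' * z)
      - (cmult (s * c / r) (cmult r (z * w)) - cmult c (cmult s (z * w')))"
    using rs by (simp add: algebra_simps cmult_simps)
  also have "dcong n \<dots> (cmult c (w * z) - cmult c (w' * z)
      - (cmult (s * c / r) (w * z) - cmult c (w' * z)))"
    using wz wz' carr
    by (intro dcong_intros dcong_refl dcong_sym[of _ _ "cmult _ _"])
      (auto simp: qcomm_def intro: carrier_intros)
  also have "\<dots> = cmult (c - s * c / r) (w * z)"
    by (simp add: cmult.scale_left_diff_distrib)
  also have "c - s * c / r = 1 / r"
  proof -
    have "c - s * c / r = (r - s) * c / r"
      using rs(1) by (simp add: field_simps)
    then show ?thesis using rs(2) by (simp add: c_def)
  qed
  finally show ?thesis .
qed

text \<open>Mirror image of \<open>peel_minus\<close>: the commutator with \<open>y\<close> hits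
  only \<open>x\<close>. Now \<open>w\<close> cancels in the \<open>r\<close>-bracket, its weight
  being 1/r, and \<open>w'\<close> survives with coefficient (r/s - 1)/(r - s) = 1/s.\<close>

lemma peel_plus:
  assumes xy: "dcong n (x * y - y * x) (cmult (1 / (r - s)) (w - w'))"
    and yz: "qcomm n 1 y z" and wz: "qcomm n (1 / r) w z" and wz': "qcomm n (1 / s) w' z"
    and x: "x \<in> fcarr n" and rs: "r \<noteq> 0" "s \<noteq> 0" "r \<noteq> s"
  shows "dcong n (qbracket r z x * y - y * qbracket r z x) (cmult (1 / s) (z * w'))"
proof -
  define c where "c = 1 / (r - s)"
  have carr: "y \<in> fcarr n" "z \<in> fcarr n" "w \<in> fcarr n" "w' \<in> fcarr n"
    using yz wz wz' by (auto simp: qcomm_def)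
  have yz0: "dcong n (y * z - z * y) 0"
    using dcong_diff[of n "y * z" "z * y" "z * y" "z * y"] yz carr
    by (auto simp: qcomm_def intro: dcong_refl carrier_intros)
  have "qbracket r z x * y - y * qbracket r z x
    = z * (x * y - y * x) - cmult r ((x * y - y * x) * z)
      + (cmult r (x * (y * z - z * y)) - (y * z - z * y) * x)"
    by (simp add: qbracket_cmult algebra_simps cmult_simps)
  also have "dcong n \<dots> (z * cmult c (w - w') - cmult r (cmult c (w - w') * z)
      + (cmult r (x * 0) - 0 * x))"
    using xy carr x by (intro dcong_intros yz0 dcong_refl) (auto simp: c_def)
  also have "z * cmult c (w - w') - cmult r (cmult c (w - w') * z) + (cmult r (x * 0) - 0 * x)
    = cmult c (z * w) - cmult c (z * w') - (cmult (r * c) (w * z) - cmult (r * c) (w' * z))"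
    by (simp add: algebra_simps cmult_simps)
  also have "dcong n \<dots> (cmult c (z * w) - cmult c (z * w')
      - (cmult (r * c) (cmult (1 / r) (z * w)) - cmult (r * c) (cmult (1 / s) (z * w'))))"
    using wz wz' carr
    by (intro dcong_intros dcong_refl) (auto simp: qcomm_def intro: carrier_intros)
  also have "\<dots> = cmult (r * c / s - c) (z * w')"
    using rs by (simp add: cmult.scale_left_diff_distrib)
  also have "r * c / s - c = 1 / s"
  proof -
    have "r * c / s - c = (r - s) * c / s"
      using rs(2) by (simp add: field_simps)
    then show ?thesis using rs(3) by (simp add: c_def)
  qed
  finally show ?thesis .
qed

lemma x_upto_carrier:
  assumes "m < n"
  shows "x_minus_upto m \<in> fcarr n" "x_plus_upto m \<in> fcarr n"
  using assms by (induction m rule: x_minus_upto.induct) (auto intro!: carrier_intros)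

text \<open>The commutator of the outermost bracket with \<open>xx Pos (Suc m) 0\<close> is, by
  \<open>peel_minus\<close>, the inner bracket times a unit of the subalgebra.\<close>

lemma x_minus_upto_descend:
  assumes "m \<ge> 1" "Suc m < n" "x_minus_upto (Suc m) \<in> U_pre n"
  shows "x_minus_upto m \<in> U_pre n"
proof -
  define z where "z = x_minus_upto m"
  have I: "Suc m \<in> {1..<n}" using assms by simp
  have X: "x_minus_upto (Suc m) = qbracket par_s (xx Neg (Suc m) 0) z"
    using assms(1) by (cases m) (simp_all add: z_def)
  have "qcomm n (\<Prod>j=1..m. 1) (xx Pos (Suc m) 0) z"
    unfolding z_def using assms by (intro qcomm_x_minus_upto qcomm_xx) auto
  then have x: "qcomm n 1 (xx Pos (Suc m) 0) z" by simp
  have "qcomm n (\<Prod>j=1..m. pairing j (Suc m) (sg Neg)) (om Pos (Suc m)) z"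
    unfolding z_def using assms by (intro qcomm_x_minus_upto qcomm_om) auto
  \<comment> \<open>Among the indices 1 to \<open>m\<close> only \<open>m\<close> is adjacent to
    \<open>Suc m\<close> in the Dynkin diagram, so a single factor differs from 1.\<close>
  also have "(\<Prod>j=1..m. pairing j (Suc m) (sg Neg)) = (\<Prod>j=1..m. if j = m then par_r else 1)"
    by (intro prod.cong) (auto simp: pairing_eq eps_root_def)
  finally have w: "qcomm n par_r (om Pos (Suc m)) z" using assms by simp
  have "qcomm n (\<Prod>j=1..m. pairing (Suc m) j (- sg Neg)) (om' Pos (Suc m)) z"
    unfolding z_def using assms by (intro qcomm_x_minus_upto qcomm_om') auto
  also have "(\<Prod>j=1..m. pairing (Suc m) j (- sg Neg)) = (\<Prod>j=1..m. if j = m then par_s else 1)"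
    by (intro prod.cong) (auto simp: pairing_eq eps_root_def)
  finally have w': "qcomm n par_s (om' Pos (Suc m)) z" using assms by simp
  have "dcong n (xx Pos (Suc m) 0 * x_minus_upto (Suc m) - x_minus_upto (Suc m) * xx Pos (Suc m) 0)
     (cmult (1 / par_r) (om Pos (Suc m) * z))"
    unfolding X using I
    by (intro peel_minus[OF xx_bracket_0 x w w'])
      (auto simp: par_nonzero par_r_neq_par_s intro: carrier_intros)
  then have "cmult (1 / par_r) (om Pos (Suc m) * z) \<in> U_pre n"
    by (rule U_pre_dcong[rotated]) (intro U_pre_diff U_pre_mult assms U_pre_chev I)
  then have "om Pos (Suc m) * z \<in> U_pre n"
    by (rule U_pre_cmult_cancel) (simp add: par_nonzero)
  then have "z \<in> U_pre n"
    by (rule U_pre_cancel_left[where w = "om Neg (Suc m)"])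
      (use I assms in \<open>auto intro: U_pre_chev dcong_generator_inverse simp: z_def x_upto_carrier\<close>)
  then show ?thesis by (simp add: z_def)
qed

text \<open>Dual descent through \<open>peel_plus\<close>; the surviving unit is
  \<open>om' Pos (Suc m)\<close>, and it stands on the right.\<close>

lemma x_plus_upto_descend:
  assumes "m \<ge> 1" "Suc m < n" "x_plus_upto (Suc m) \<in> U_pre n"
  shows "x_plus_upto m \<in> U_pre n"
proof -
  define z where "z = x_plus_upto m"
  have I: "Suc m \<in> {1..<n}" using assms by simp
  have X: "x_plus_upto (Suc m) = qbracket par_r z (xx Pos (Suc m) 0)"
    using assms(1) by (cases m) (simp_all add: z_def)
  have "qcomm n (\<Prod>j=1..m. 1) (xx Neg (Suc m) 0) z"
    unfolding z_def using assms by (intro qcomm_x_plus_upto qcomm_xx) auto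
  then have y: "qcomm n 1 (xx Neg (Suc m) 0) z" by simp
  have "qcomm n (\<Prod>j=1..m. pairing j (Suc m) (sg Pos)) (om Pos (Suc m)) z"
    unfolding z_def using assms by (intro qcomm_x_plus_upto qcomm_om) auto
  also have "(\<Prod>j=1..m. pairing j (Suc m) (sg Pos)) = (\<Prod>j=1..m. if j = m then 1 / par_r else 1)"
    by (intro prod.cong) (auto simp: pairing_eq eps_root_def field_simps)
  finally have w: "qcomm n (1 / par_r) (om Pos (Suc m)) z" using assms by simp
  have "qcomm n (\<Prod>j=1..m. pairing (Suc m) j (- sg Pos)) (om' Pos (Suc m)) z"
    unfolding z_def using assms by (intro qcomm_x_plus_upto qcomm_om') auto
  also have "(\<Prod>j=1..m. pairing (Suc m) j (- sg Pos))
      = (\<Prod>j=1..m. if j = m then 1 / par_s else 1)"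
    by (intro prod.cong) (auto simp: pairing_eq eps_root_def field_simps)
  finally have w': "qcomm n (1 / par_s) (om' Pos (Suc m)) z" using assms by simp
  have "dcong n (x_plus_upto (Suc m) * xx Neg (Suc m) 0 - xx Neg (Suc m) 0 * x_plus_upto (Suc m))
     (cmult (1 / par_s) (z * om' Pos (Suc m)))"
    unfolding X using I
    by (intro peel_plus[OF xx_bracket_0 y w w'])
      (auto simp: par_nonzero par_r_neq_par_s intro: carrier_intros)
  then have "cmult (1 / par_s) (z * om' Pos (Suc m)) \<in> U_pre n"
    by (rule U_pre_dcong[rotated]) (intro U_pre_diff U_pre_mult assms U_pre_chev I)
  then have "z * om' Pos (Suc m) \<in> U_pre n"
    by (rule U_pre_cmult_cancel) (simp add: par_nonzero)
  then have "z \<in> U_pre n"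
    by (rule U_pre_cancel_right[where w = "om' Neg (Suc m)"])
      (use I assms in \<open>auto intro: U_pre_chev dcong_generator_inverse simp: z_def x_upto_carrier\<close>)
  then show ?thesis by (simp add: z_def)
qed

section \<open>Inverses of torus products and the vectors for the highest root\<close>

text \<open>With one list reversed, mutually inverse factors meet in the middle and the product
  telescopes without commuting anything.\<close>

lemma dcong_prod_list_inverse:
  assumes "\<And>x. x \<in> set xs \<Longrightarrow> dcong n (f x * g x) 1 \<and> f x \<in> fcarr n \<and> g x \<in> fcarr n"
  shows "dcong n (prod_list (map f (rev xs)) * prod_list (map g xs)) 1"
  using assms
proof (induction xs)
  case Nil
  then show ?case by (simp add: dcong_refl one_carrier)
next
  case (Cons x xs)
  have carr: "prod_list (map f (rev xs)) \<in> fcarr n" "prod_list (map g xs) \<in> fcarr n"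
    using Cons.prems by (auto intro!: prod_list_carrier)
  have "dcong n (prod_list (map f (rev xs)) * (f x * g x) * prod_list (map g xs))
      (prod_list (map f (rev xs)) * 1 * prod_list (map g xs))"
    using Cons.prems carr by (intro dcong_mult dcong_refl) auto
  also have "dcong n \<dots> 1" using Cons by simp
  finally show ?case by (simp add: mult.assoc)
qed

lemma dcong_power_inverse:
  assumes "dcong n (u * v) 1" "u \<in> fcarr n" "v \<in> fcarr n"
  shows "dcong n (u ^ k * v ^ k) 1"
proof (induction k)
  case 0
  show ?case by (simp add: dcong_refl one_carrier)
next
  case (Suc k)
  have "u ^ Suc k * v ^ Suc k = u * (u ^ k * v ^ k) * v"
    by (simp add: mult.assoc power_commutes)
  also have "dcong n \<dots> (u * 1 * v)"
    using Suc assms by (intro dcong_mult dcong_refl)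
  also have "dcong n \<dots> 1" using assms(1) by simp
  finally show ?case .
qed

lemma dcong_gam_inverse: "dcong n (gam m * gam (- m)) 1" "dcong n (gam' m * gam' (- m)) 1"
  by (auto simp: gam_def gam'_def gam_0 dcong_refl one_carrier intro!: dcong_power_inverse
      dcong_generator_inverse torus_carrier)

text \<open>The generator \<open>chev_E n 0\<close> is this vector times torus units on the right,
  which are cancelled one after the other.\<close>

lemma x_minus_theta_U_pre:
  assumes "n > 1"
  shows "x_minus_upto (n - 1) \<in> U_pre n"
proof -
  have "chev_E n 0 \<in> U_pre n"
    using assms by (intro U_pre_gen)
      (auto simp: chev_generators_def chev_E_def om_theta_inv_def intro!: carrier_intros x_upto_carrier)
  then have "x_minus_upto (n - 1) * gam' (- 2) * om_theta_inv n \<in> U_pre n"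
    by (simp add: chev_E_def)
  then have "x_minus_upto (n - 1) * gam' (- 2) \<in> U_pre n"
    by (rule U_pre_cancel_right[where w = "om_theta n"])
      (use assms in \<open>auto simp: om_theta_def om_theta_inv_def intro!: U_pre_prod_list U_pre_chev
        dcong_prod_list_inverse dcong_generator_inverse carrier_intros x_upto_carrier\<close>)
  then show ?thesis
    by (rule U_pre_cancel_right[where w = "gam' 2"])
      (use assms dcong_gam_inverse(2)[of n "- 2"] in \<open>auto intro!: U_pre_gam x_upto_carrier\<close>)
qed

lemma x_plus_theta_U_pre:
  assumes "n > 1"
  shows "x_plus_upto (n - 1) \<in> U_pre n"
proof -
  have inv: "dcong n (om_theta' n * om_theta_inv' n) 1"
    unfolding om_theta'_def om_theta_inv'_def
    \<comment> \<open>Here the increasing product must stand on the left, so the telescoping lemma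
      is applied to the reversed index list.\<close>
    by (rule dcong_prod_list_inverse[of "rev [1..<n]" n "om' Pos" "om' Neg", simplified rev_rev_ident])
      (auto intro: dcong_generator_inverse carrier_intros)
  have carr: "om_theta_inv' n \<in> fcarr n"
    by (auto simp: om_theta_inv'_def intro!: carrier_intros)
  have "chev_F n 0 \<in> U_pre n"
    using assms carr by (intro U_pre_gen)
      (auto simp: chev_generators_def chev_F_def intro!: carrier_intros x_upto_carrier)
  then have "gam (- 2) * (om_theta_inv' n * x_plus_upto (n - 1)) \<in> U_pre n"
    by (simp add: chev_F_def mult.assoc)
  then have "om_theta_inv' n * x_plus_upto (n - 1) \<in> U_pre n"
    by (rule U_pre_cancel_left[where w = "gam 2"])
      (use assms carr dcong_gam_inverse(1)[of n 2] in
        \<open>auto intro!: U_pre_gam mult_carrier x_upto_carrier\<close>)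
  then show ?thesis
    by (rule U_pre_cancel_left[where w = "om_theta' n"])
      (use assms inv in \<open>auto simp: om_theta'_def intro!: U_pre_prod_list U_pre_chev x_upto_carrier\<close>)
qed

lemma x_1_U_pre:
  assumes "n > 1"
  shows "xx Neg 1 1 \<in> U_pre n" "xx Pos 1 (- 1) \<in> U_pre n"
proof -
  \<comment> \<open>The induction counts the peeled brackets, since the descent runs downwards. The
    bound on \<open>k\<close> keeps the index at least 1, away from the dummy value at 0.\<close>
  have "x_minus_upto (n - 1 - k) \<in> U_pre n \<and> x_plus_upto (n - 1 - k) \<in> U_pre n"
    if "k \<le> n - 2" for k
    using that
  proof (induction k)
    case 0
    show ?case using assms x_minus_theta_U_pre x_plus_theta_U_pre by simp
  next
    case (Suc k)
    have "Suc (n - 1 - Suc k) = n - 1 - k" using Suc.prems by simp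
    then show ?case
      using Suc x_minus_upto_descend[of "n - 1 - Suc k" n] x_plus_upto_descend[of "n - 1 - Suc k" n]
      by simp
  qed
  from this[of "n - 2"] have "x_minus_upto 1 \<in> U_pre n \<and> x_plus_upto 1 \<in> U_pre n"
    using assms by (simp add: numeral_2_eq_2 Suc_diff_Suc)
  then show "xx Neg 1 1 \<in> U_pre n" "xx Pos 1 (- 1) \<in> U_pre n" by simp_all
qed

section \<open>Generating all modes\<close>

text \<open>By (D6) the commutator with \<open>aa i l\<close> is the shifted vector times a nonzero
  scalar and a power of \<gamma> or \<gamma>', all invertible inside the subalgebra.\<close>

lemma xx_shift_U_pre:
  assumes "i \<in> {1..<n}" "j \<in> {1..<n}" "l \<noteq> 0" "cartan i j \<noteq> 0"
    and "aa i l \<in> U_pre n" "xx e j k \<in> U_pre n"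
  shows "xx e j (l + k) \<in> U_pre n"
proof -
  define c where "c = of_int (sg e) * heis_coeff i j l / of_int l"
  define g where "g = (if l < 0 then gam else gam')"
  have "c \<noteq> 0"
    using heis_coeff_nonzero[of l i j] assms(3,4) by (cases e) (auto simp: c_def)
  have "(if l < 0 then gam (sg e * l) else gam' (sg e * l)) = g (sg e * l)"
    by (simp add: g_def)
  then have "dcong n (qbracket 1 (aa i l) (xx e j k)) (cmult c (g (sg e * l) * xx e j (l + k)))"
    using dcong_rel[OF D6[OF assms(1-3), of e k]]
    by (simp only: c_def cmult_def mult.assoc)
  then have "cmult c (g (sg e * l) * xx e j (l + k)) \<in> U_pre n"
    using U_pre_dcong U_pre_qbracket assms(5,6) by blast
  then have "g (sg e * l) * xx e j (l + k) \<in> U_pre n"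
    using \<open>c \<noteq> 0\<close> by (rule U_pre_cmult_cancel)
  then show ?thesis
  proof (rule U_pre_cancel_left)
    show "g (- (sg e * l)) \<in> U_pre n" by (simp add: g_def U_pre_gam)
    show "dcong n (g (- (sg e * l)) * g (sg e * l)) 1"
      using dcong_gam_inverse[of n "- (sg e * l)"] by (simp add: g_def)
    show "xx e j (l + k) \<in> fcarr n" by (rule indexed_gen_carrier(1)[OF assms(2)])
  qed
qed

text \<open>Starting from the Chevalley generator at mode 0, shifts by 1 and -1 reach every
  mode.\<close>

lemma xx_all_U_pre:
  assumes "i \<in> {1..<n}" "j \<in> {1..<n}" "cartan i j \<noteq> 0"
    and "aa i 1 \<in> U_pre n" "aa i (- 1) \<in> U_pre n"
  shows "xx e j k \<in> U_pre n"
proof (induction k rule: int_induct[where k = 0])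
  case base
  show ?case by (rule U_pre_chev(1)[OF assms(2)])
next
  case (step1 k)
  then show ?case
    using xx_shift_U_pre[OF assms(1,2) _ assms(3,4), of e k] by (simp add: add.commute)
next
  case (step2 k)
  then show ?case
    using xx_shift_U_pre[OF assms(1,2) _ assms(3,5), of e k] by simp
qed

section \<open>From the root vectors to the Heisenberg generators\<close>

text \<open>Off total mode 0 only one of the two terms on the right of (D8) is nonzero:
  \<open>om_mode\<close> for positive and \<open>om_mode'\<close> for negative total mode. Its
  central prefactors are units of the subalgebra.\<close>

lemma om_mode_U_pre:
  assumes i: "i \<in> {1..<n}" and x: "xx Pos i k \<in> U_pre n" "xx Neg i k' \<in> U_pre n"
  shows "k + k' > 0 \<Longrightarrow> om_mode i (k + k') \<in> U_pre n"
    and "k + k' < 0 \<Longrightarrow> om_mode' i (k + k') \<in> U_pre n"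
proof -
  define c where "c = 1 / (par_r - par_s)"
  have c: "c \<noteq> 0" by (simp add: c_def par_r_neq_par_s)
  have rel: "dcong n (qbracket 1 (xx Pos i k) (xx Neg i k'))
    (cmult c (gam' (- 2 * k) * gam (- (k + k')) * om_mode i (k + k') -
           gam (2 * k') * gam' (k + k') * om_mode' i (k + k')))"
    using dcong_rel[OF D8[OF i i, of k k']] by (simp add: c_def cmult_def)
  have mem: "gam' (- 2 * k) * gam (- (k + k')) * om_mode i (k + k') -
           gam (2 * k') * gam' (k + k') * om_mode' i (k + k') \<in> U_pre n"
    by (rule U_pre_cmult_cancel[OF U_pre_dcong[OF U_pre_qbracket[OF x] rel] c])
  note carr = om_mode_carrier[OF i] gam_carrier gam'_carrier
  {
    assume "k + k' > 0"
    then have "gam' (- 2 * k) * (gam (- (k + k')) * om_mode i (k + k')) \<in> U_pre n"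
      using mem by (simp add: om_mode'_def mult.assoc)
    then have "gam (- (k + k')) * om_mode i (k + k') \<in> U_pre n"
      by (rule U_pre_cancel_left[OF _ U_pre_gam(2)])
        (use dcong_gam_inverse(2)[of n "2 * k"] in \<open>simp_all add: mult_carrier carr\<close>)
    then show "om_mode i (k + k') \<in> U_pre n"
      by (rule U_pre_cancel_left[OF _ U_pre_gam(1)])
        (use dcong_gam_inverse(1)[of n "k + k'"] in \<open>simp_all add: carr\<close>)
  next
    assume "k + k' < 0"
    then have "cmult (- 1) (gam (2 * k') * (gam' (k + k') * om_mode' i (k + k'))) \<in> U_pre n"
      using mem by (simp add: om_mode_def mult.assoc)
    then have "gam (2 * k') * (gam' (k + k') * om_mode' i (k + k')) \<in> U_pre n"
      by (rule U_pre_cmult_cancel) simp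
    then have "gam' (k + k') * om_mode' i (k + k') \<in> U_pre n"
      by (rule U_pre_cancel_left[OF _ U_pre_gam(1)])
        (use dcong_gam_inverse(1)[of n "- (2 * k')"] in \<open>simp_all add: mult_carrier carr\<close>)
    then show "om_mode' i (k + k') \<in> U_pre n"
      by (rule U_pre_cancel_left[OF _ U_pre_gam(2)[of "- (k + k')"]])
        (use dcong_gam_inverse(2)[of n "- (k + k')"] in \<open>simp_all add: carr add.commute\<close>)
  }
qed

lemma fps_power_U_pre:
  assumes "\<And>l. l < m \<Longrightarrow> fps_nth A l \<in> U_pre n"
  shows "l < m \<Longrightarrow> fps_nth (A ^ j) l \<in> U_pre n"
proof (induction j arbitrary: l)
  case 0
  then show ?case by (simp add: U_pre_0 U_pre_1)
next
  case (Suc j)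
  then show ?case
    by (auto simp: fps_mult_nth intro!: U_pre_sum U_pre_mult assms)
qed

text \<open>Without a constant term in \<open>A\<close>, the \<open>m\<close>-th coefficient of the
  exponential is that of \<open>A\<close> plus a noncommutative polynomial in strictly lower
  coefficients. This makes the recursion for \<open>aa\<close> triangular.\<close>

lemma fps_exp_nc_U_pre:
  assumes A: "fps_nth A 0 = 0" "\<And>l. l < m \<Longrightarrow> fps_nth A l \<in> U_pre n" and m: "m > 0"
  shows "fps_nth (fps_exp_nc A) m - fps_nth A m \<in> U_pre n"
proof -
  let ?t = "\<lambda>j. scal (1 / of_nat (fact j)) * fps_nth (A ^ j) m"
  have power: "fps_nth (A ^ Suc (Suc j)) m \<in> U_pre n" for j
  proof -
    have "fps_nth A l * fps_nth (A ^ Suc j) (m - l) \<in> U_pre n" if "l \<le> m" for l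
    \<comment> \<open>Both extreme terms of the convolution vanish because \<open>A\<close> and its
      positive powers have no constant term; all other terms involve only indices below
      \<open>m\<close>.\<close>
    proof (cases "l = 0 \<or> l = m")
      case True
      then show ?thesis using A(1) by (auto simp: U_pre_0)
    next
      case False
      then have "l < m" "m - l < m" using that by auto
      then show ?thesis using fps_power_U_pre[OF A(2)] A(2) by (blast intro: U_pre_mult)
    qed
    then show ?thesis
      unfolding power_Suc[of A "Suc j"] fps_mult_nth by (intro U_pre_sum) simp
  qed
  have "fps_nth (fps_exp_nc A) m = sum ?t {..m}"
    by (simp add: fps_exp_nc_def)
  \<comment> \<open>Since \<open>m > 0\<close>, power 0 contributes nothing to this coefficient, and
    power 1 contributes exactly the coefficient of \<open>A\<close>.\<close>
  also have "\<dots> = sum ?t {..<2} + sum ?t {2..m}"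
    using m by (subst sum.union_disjoint[symmetric]) (auto intro!: sum.cong)
  also have "sum ?t {..<2} = fps_nth A m"
    using m by (simp add: numeral_2_eq_2)
  finally have "fps_nth (fps_exp_nc A) m - fps_nth A m = sum ?t {2..m}" by simp
  also have "?t j \<in> U_pre n" if "j \<in> {2..m}" for j
  proof -
    have "j = Suc (Suc (j - 2))" using that unfolding atLeastAtMost_iff by arith
    then show ?thesis using power[of "j - 2"] by (metis U_pre_mult U_pre_scal)
  qed
  then have "sum ?t {2..m} \<in> U_pre n" by (rule U_pre_sum)
  finally show ?thesis .
qed

text \<open>One recursion step for both exponential series, with \<sigma> selecting the series:
  cancel the leading torus element, subtract the part built from lower modes, and divide by the
  scalar.\<close>

lemma aa_U_pre_step:
  assumes i: "i \<in> {1..<n}" and m: "m > 0" and sg: "\<sigma> = 1 \<or> \<sigma> = - 1"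
    and mode: "(if \<sigma> = 1 then om_mode i (int m) else om_mode' i (- int m)) \<in> U_pre n"
    and less: "\<And>l. 0 < l \<Longrightarrow> l < m \<Longrightarrow> aa i (\<sigma> * int l) \<in> U_pre n"
  shows "aa i (\<sigma> * int m) \<in> U_pre n"
proof -
  \<comment> \<open>The sign \<sigma> absorbs the minus sign in the exponent of the series for
    \<open>om_mode'\<close>.\<close>
  define c where "c = of_int \<sigma> * (par_r - par_s)"
  have c: "c \<noteq> 0" using sg by (auto simp: c_def par_r_neq_par_s)
  define A where "A = Abs_fps (\<lambda>l. if l = 0 then 0 else cmult c (aa i (\<sigma> * int l)))"
  have A_eq:
    "\<sigma> = 1 \<Longrightarrow> A = Abs_fps (\<lambda>l. if l = 0 then 0 else scal (par_r - par_s) * aa i (int l))"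
    "\<sigma> = - 1 \<Longrightarrow> A = Abs_fps (\<lambda>l. if l = 0 then 0 else - (scal (par_r - par_s) * aa i (- int l)))"
    by (auto simp: A_def c_def cmult_def scal_diff algebra_simps intro!: fps_ext)
  define w where "w = (if \<sigma> = 1 then om else om')"
  have ser: "(if \<sigma> = 1 then om_series i else om_series' i) = fps_const (w Pos i) * fps_exp_nc A"
    using sg by (auto simp: om_series_def om_series'_def w_def A_eq)
  have "(if \<sigma> = 1 then om_mode i (int m) else om_mode' i (- int m))
      = fps_nth (if \<sigma> = 1 then om_series i else om_series' i) m"
    by (simp add: om_mode_def om_mode'_def)
  then have mode': "w Pos i * fps_nth (fps_exp_nc A) m \<in> U_pre n"
    using mode unfolding ser by simp
  have Acarr: "fps_nth A l \<in> fcarr n" for l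
    using i sg by (auto simp: A_def intro!: zero_carrier cmult_carrier indexed_gen_carrier)
  have "fps_nth (fps_exp_nc A) m \<in> U_pre n"
  proof (rule U_pre_cancel_left[OF mode'])
    show "w Neg i \<in> U_pre n" using U_pre_chev[OF i] by (simp add: w_def)
    show "dcong n (w Neg i * w Pos i) 1"
      using i by (simp add: w_def dcong_generator_inverse)
    show "fps_nth (fps_exp_nc A) m \<in> fcarr n" by (rule fps_exp_nc_carrier[OF Acarr])
  qed
  moreover have "fps_nth (fps_exp_nc A) m - fps_nth A m \<in> U_pre n"
    using m less by (intro fps_exp_nc_U_pre) (auto simp: A_def U_pre_0 U_pre_cmult)
  ultimately have "fps_nth A m \<in> U_pre n"
    using U_pre_diff by fastforce
  then have "cmult c (aa i (\<sigma> * int m)) \<in> U_pre n" using m by (simp add: A_def)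
  then show ?thesis using c by (rule U_pre_cmult_cancel)
qed

text \<open>At mode 1 or -1 the recursion has no lower terms. The modes of \<omega> and \<omega>' it
  needs come from pairing each given vector with a Chevalley generator of mode 0.\<close>

lemma aa_unit_U_pre:
  assumes "i \<in> {1..<n}" "xx Neg i 1 \<in> U_pre n" "xx Pos i (- 1) \<in> U_pre n"
  shows "aa i 1 \<in> U_pre n" "aa i (- 1) \<in> U_pre n"
  using aa_U_pre_step[OF assms(1), of 1 1] aa_U_pre_step[OF assms(1), of 1 "- 1"]
    om_mode_U_pre(1)[OF assms(1) U_pre_chev(1)[OF assms(1)] assms(2)]
    om_mode_U_pre(2)[OF assms(1) assms(3) U_pre_chev(1)[OF assms(1)]]
  by simp_all

lemma aa_all_U_pre:
  assumes i: "i \<in> {1..<n}" and x: "\<And>e k. xx e i k \<in> U_pre n" and l: "l \<noteq> 0"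
  shows "aa i l \<in> U_pre n"
proof -
  have "aa i (\<sigma> * int m) \<in> U_pre n" if \<sigma>: "\<sigma> = 1 \<or> \<sigma> = - 1" and "m > 0" for \<sigma> m
    using \<open>m > 0\<close>
  proof (induction m rule: less_induct)
    case (less m)
    show ?case
    proof (rule aa_U_pre_step[OF i less.prems \<sigma>])
      show "(if \<sigma> = 1 then om_mode i (int m) else om_mode' i (- int m)) \<in> U_pre n"
        using om_mode_U_pre(1)[OF i x x, of 0 "int m"] om_mode_U_pre(2)[OF i x x, of 0 "- int m"]
          less.prems by simp
    qed (use less.IH in auto)
  qed
  \<comment> \<open>Each nonzero \<open>l\<close> is its sign times its absolute value, so the
    induction on the absolute value covers both signs.\<close>
  from this[of "sgn l" "nat \<bar>l\<bar>"] show ?thesis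
    using l by (cases "l > 0") simp_all
qed

text \<open>Induction along the Dynkin diagram. At the first node \<open>aa 1\<close> of modes 1 and
  -1 shifts the vectors of that node, the Cartan entry being 2; afterwards \<open>aa i\<close>
  shifts those of node \<open>Suc i\<close>, the entry being -1.\<close>

lemma xx_U_pre:
  assumes "n > 1" "i \<in> {1..<n}"
  shows "xx e i k \<in> U_pre n"
  using assms(2)
proof (induction i arbitrary: e k rule: nat_induct)
  case 0
  then show ?case by simp
next
  case (Suc i)
  show ?case
  proof (cases "i = 0")
    case True
    have I: "1 \<in> {1..<n}" using assms by simp
    show ?thesis
      using xx_all_U_pre[OF I I _ aa_unit_U_pre[OF I x_1_U_pre[OF assms(1)]]] True
      by (simp add: cartan_def eps_root_def)
  next
    case False
    then have I: "i \<in> {1..<n}" using Suc.prems by simp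
    show ?thesis
      using xx_all_U_pre[OF I Suc.prems _ aa_unit_U_pre[OF I Suc.IH[OF I] Suc.IH[OF I]]]
      by (simp add: cartan_def eps_root_def)
  qed
qed

theorem lemma4p8:
  fixes n i :: nat
  assumes "n > 2" and "i \<in> {1..<n}"
  shows "(\<forall>l. l \<noteq> 0 \<longrightarrow> U_proj n (aa i l) \<in> U_sub n) \<and>
         (\<forall>e k. U_proj n (xx e i k) \<in> U_sub n)"
proof -
  have x: "xx e i k \<in> U_pre n" for e k
    using assms by (intro xx_U_pre) auto
  moreover have "aa i l \<in> U_pre n" if "l \<noteq> 0" for l
    by (rule aa_all_U_pre[OF assms(2) x that])
  ultimately show ?thesis by (simp add: U_pre_def)
qed

end
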